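(* Let $f:\mathbb{R}^n\to[0,\infty)$ be convex and even with $f(0)=0$, and let $f_*$ be its spherically symmetric increasing rearrangement. Then $$|\{\mathcal{L}f\le\lambda\}|\ \le\ |\{\mathcal{L}f_*\le\lambda\}|\qquad\text{for all }\lambda\in\mathbb{R},$$ where $\mathcal{L}g(x)=\sup_{y\in\mathbb{R}^n}\big[\langle x,y\rangle-g(y)\big]$ is the Legendre transform of $g$ (which may take the value $+\infty$).
   Context: $|\cdot|$ is Lebesgue measure on $\mathbb{R}^n$ and $\langle\cdot,\cdot\rangle$ the Euclidean scalar product. For a Borel set $A\subseteq\mathbb{R}^n$, $A^*=\{x:\|x\|<r\}$ is the open Euclidean ball centered at $0$ with $|A^*|=|A|$ (so $A^*=\emptyset$ if $|A|=0$ and $A^*=\mathbb{R}^n$ if $|A|=\infty$). For measurable $g\ge0$, $g^*(y)=\int_0^\infty\mathbf{1}_{\{g>s\}^*}(y)\,ds$. The spherically symmetric increasing rearrangement of a measurable $f:\mathbb{R}^n\to\mathbb{R}$ is $f_*=-\log\big((e^{-f})^*\big)$; it satisfies $\{f_*<\lambda\}=\{f<\lambda\}^*$ for all $\lambda\in\mathbb{R}$. *)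

theory Defs
  imports "HOL-Analysis.Analysis"
begin

definition symm_set :: "'a::euclidean_space set \<Rightarrow> 'a set" where
  "symm_set A =
     (if emeasure lebesgue A = \<infinity> then UNIV
      else ball 0 (THE r. 0 \<le> r \<and> emeasure lebesgue (ball (0::'a) r) = emeasure lebesgue A))"

definition symm_decr :: "('a::euclidean_space \<Rightarrow> real) \<Rightarrow> 'a \<Rightarrow> ennreal" where
  "symm_decr g y = (\<integral>\<^sup>+ s \<in> {0..}. indicator (symm_set {x. s < g x}) y \<partial>lborel)"

definition ext_ln :: "ennreal \<Rightarrow> ereal" where
  "ext_ln a = (if a = 0 then - \<infinity> else if a = \<infinity> then \<infinity> else ereal (ln (enn2real a)))"

text \<open>The rearrangement of a real-valued function is extended-real-valued, since its
  decreasing rearrangement may a priori be infinite or vanish at some points.\<close>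

definition symm_incr :: "('a::euclidean_space \<Rightarrow> real) \<Rightarrow> 'a \<Rightarrow> ereal" where
  "symm_incr f y = - ext_ln (symm_decr (\<lambda>x. exp (- f x)) y)"

definition legendre :: "('a::euclidean_space \<Rightarrow> ereal) \<Rightarrow> 'a \<Rightarrow> ereal" where
  "legendre g x = (SUP y. ereal (x \<bullet> y) - g y)"

end

theory Submission
  imports Defs
begin

text \<open>
  The statement is a pointwise form of the Blaschke-Santalo inequality. Write \<open>A t = {f < t}\<close>;
  for \<open>t > 0\<close> this is an open, convex, origin-symmetric set. If \<open>legendre f x \<le> lam\<close> then
  \<open>x \<bullet> y \<le> lam + t\<close> for every \<open>y \<in> A t\<close>, so the sublevel set of the Legendre transform lies in
  \<open>(lam + t) \<cdot> polar (A t)\<close>, for each \<open>t\<close> separately. By Blaschke-Santalo, its volume \<open>V\<close> satisfies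
  \<open>|A t| V \<le> (lam + t)^n |B|^2\<close>. If \<open>r t\<close> and \<open>\<rho>\<close> denote the radii of the balls of volume \<open>|A t|\<close> and
  \<open>V\<close>, this reads \<open>r t \<cdot> \<rho> \<le> lam + t\<close>. For the rearranged function the level sets are the balls of
  radius \<open>r t\<close>, and the family of these inequalities says precisely that the ball of radius \<open>\<rho>\<close> lies
  in the sublevel set of its Legendre transform. Nothing is lost by treating the levels one at a
  time, because concentric balls are nested: the intersection of their scaled polars is one of them
  or a limit of them.

  The Blaschke-Santalo inequality \<open>|K| |polar K| \<le> |B|^2\<close> for convex symmetric \<open>K\<close> is obtained
  by making \<open>K\<close> unconditional, that is, invariant under all coordinate reflections. Steiner
  symmetrisation along a coordinate axis preserves \<open>|K|\<close>, does not decrease \<open>|polar K|\<close>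
  (\<open>emeasure_polar_le_polar_steiner\<close>), creates the reflection symmetry in that coordinate and keeps
  the reflection symmetries already present. After one pass over the coordinates \<open>K\<close> is
  unconditional. For unconditional \<open>K\<close>,
  every \<open>x \<in> K\<close> and \<open>y \<in> polar K\<close> satisfy \<open>(\<Sum>i. \<bar>x i * y i\<bar>) \<le> 1\<close>, so any \<open>z\<close> with
  \<open>(z i)^2 = \<bar>x i * y i\<bar>\<close> lies in the unit ball, and a Prekopa-Leindler inequality for
  coordinatewise geometric means finishes the proof.

  Both steps rest on inequalities of Prekopa-Leindler type in several variables, one for the
  combination \<open>(x - y) / 2\<close> and one for \<open>\<plusminus>sqrt \<bar>x y\<bar>\<close>. A single induction on the number of
  coordinates (\<open>Prekopa_Leindler_tensorise\<close>) derives each of them from its one-dimensional case; the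
  latter comes from the one-dimensional Brunn-Minkowski inequality.
\<close>

section \<open>Prekopa-Leindler inequality on the line\<close>

text \<open>A measurable set of reals need not contain its supremum, so it may have no last point at which to
  cut it. This lemma replaces a missing maximum by exhaustion from below. The additive constant
  \<open>k\<close> avoids subtractions of extended reals when the lemma is applied twice in a row.\<close>

lemma emeasure_add_le_if_lower_parts_add_le:
  fixes A :: "real set"
  assumes A[measurable]: "A \<in> sets borel" and ne: "A \<noteq> {}"
    and le: "\<And>a. a \<in> A \<Longrightarrow> emeasure lborel (A \<inter> {..a}) + k \<le> m"
  shows "emeasure lborel A + k \<le> m"
proof -
  \<comment> \<open>cut points below the supremum of \<open>A\<close> that tend to it, also when it is infinite\<close>
  define g where "g n = (if bdd_above A then Sup A - 1 / Suc n else real n)" for n :: nat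
  have "incseq (\<lambda>n. A \<inter> {..g n})"
    unfolding incseq_def g_def by (auto simp: frac_le intro: order_trans)
  then have "(SUP n. emeasure lborel (A \<inter> {..g n})) = emeasure lborel (\<Union>n. A \<inter> {..g n})"
    by (intro SUP_emeasure_incseq) auto
  moreover have "emeasure lborel (A \<inter> {..g n}) + k \<le> m" for n
  proof -
    have "\<exists>a\<in>A. g n < a"
    proof (cases "bdd_above A")
      case True
      then show ?thesis
        using less_cSup_iff[OF ne True, of "g n"] by (simp add: g_def)
    next
      case False
      then show ?thesis by (auto simp: g_def bdd_above_def not_le)
    qed
    then obtain a where "a \<in> A" "g n < a" by auto
    then have "emeasure lborel (A \<inter> {..g n}) \<le> emeasure lborel (A \<inter> {..a})"
      by (intro emeasure_mono) auto
    with le[OF \<open>a \<in> A\<close>] show ?thesis by (meson add_right_mono order_trans)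
  qed
  then have "(SUP n. emeasure lborel (A \<inter> {..g n}) + k) \<le> m"
    by (intro SUP_least)
  ultimately have *: "emeasure lborel (\<Union>n. A \<inter> {..g n}) + k \<le> m"
    by (simp add: ennreal_SUP_add_left)
  have "A \<subseteq> (\<Union>n. A \<inter> {..g n}) \<union> {Sup A}"
  proof
    fix x assume x: "x \<in> A"
    show "x \<in> (\<Union>n. A \<inter> {..g n}) \<union> {Sup A}"
    proof (cases "bdd_above A")
      case True
      show ?thesis
      proof (cases "x = Sup A")
        case False
        then have "0 < Sup A - x" using cSup_upper[OF x True] by auto
        then obtain n where "1 / Suc n < Sup A - x" using nat_approx_posE by blast
        then have "x \<le> g n" using True by (simp add: g_def)
        with x show ?thesis by auto
      qed auto
    next
      case False
      then show ?thesis using x real_arch_simple[of x] by (auto simp: g_def)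
    qed
  qed
  then have "emeasure lborel A \<le> emeasure lborel ((\<Union>n. A \<inter> {..g n}) \<union> {Sup A})"
    by (intro emeasure_mono) auto
  also have "\<dots> \<le> emeasure lborel (\<Union>n. A \<inter> {..g n}) + emeasure lborel {Sup A}"
    by (intro emeasure_subadditive) auto
  finally show ?thesis
    using * by (simp add: order_trans[OF add_right_mono])
qed

lemma emeasure_lborel_affine_vimage:
  fixes A :: "real set"
  assumes [measurable]: "A \<in> sets borel" and "c \<noteq> 0"
  shows "emeasure lborel A = ennreal \<bar>c\<bar> * emeasure lborel {x. t + c * x \<in> A}"
proof -
  have "emeasure lborel A = (\<integral>\<^sup>+x. indicator A x \<partial>lborel)" by simp
  also have "\<dots> = ennreal \<bar>c\<bar> * (\<integral>\<^sup>+x. indicator A (t + c * x) \<partial>lborel)"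
    by (rule nn_integral_real_affine) (use assms in auto)
  also have "(\<integral>\<^sup>+x. indicator A (t + c * x) \<partial>lborel) = (\<integral>\<^sup>+x. indicator {x. t + c * x \<in> A} x \<partial>lborel)"
    by (intro nn_integral_cong) (auto split: split_indicator)
  also have "\<dots> = emeasure lborel {x. t + c * x \<in> A}"
    by (rule nn_integral_indicator) measurable
  finally show ?thesis .
qed

text \<open>If \<open>A\<close> and \<open>B\<close> have maxima \<open>a\<close> and \<open>b\<close>, the sets \<open>(A - b) / 2\<close> and \<open>(a - B) / 2\<close> lie in \<open>C\<close> and
  meet at most in \<open>(a - b) / 2\<close>, so their measures add up. In general \<open>A\<close> and \<open>B\<close> are cut off at
  one of their points, and the cuts are then removed one after the other.\<close>

lemma Brunn_Minkowski_half_difference: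
  fixes A B C :: "real set"
  assumes [measurable]: "A \<in> sets borel" "B \<in> sets borel" "C \<in> sets borel"
    and "A \<noteq> {}" "B \<noteq> {}"
    and C: "\<And>a b. a \<in> A \<Longrightarrow> b \<in> B \<Longrightarrow> (a - b) / 2 \<in> C"
  shows "emeasure lborel A + emeasure lborel B \<le> 2 * emeasure lborel C"
proof -
  have main: "emeasure lborel (A \<inter> {..a}) + emeasure lborel (B \<inter> {..b}) \<le> 2 * emeasure lborel C"
    if a: "a \<in> A" and b: "b \<in> B" for a b
  proof -
    define X where "X = {x. b + 2 * x \<in> A \<inter> {..a}}"
    define Y where "Y = {x. a + (-2) * x \<in> B \<inter> {..b}}"
    have [measurable]: "X \<in> sets borel" "Y \<in> sets borel" unfolding X_def Y_def by measurable
    have "X \<inter> Y \<subseteq> {(a - b) / 2}" by (auto simp: X_def Y_def)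
    then have "emeasure lborel (X \<inter> Y) \<le> emeasure lborel {(a - b) / 2}"
      by (intro emeasure_mono) auto
    then have "emeasure lborel (X \<inter> Y) = 0" by simp
    then have null: "X \<inter> Y \<in> null_sets lborel" by auto
    have "emeasure lborel (A \<inter> {..a}) + emeasure lborel (B \<inter> {..b})
        = 2 * (emeasure lborel X + emeasure lborel Y)"
      unfolding X_def Y_def
      using emeasure_lborel_affine_vimage[of "A \<inter> {..a}" 2 b]
        emeasure_lborel_affine_vimage[of "B \<inter> {..b}" "-2" a]
      by (simp add: distrib_left)
    also have "emeasure lborel X + emeasure lborel Y = emeasure lborel (X \<union> Y)"
      using emeasure_Un'[OF _ _ null] by simp
    also have "\<dots> \<le> emeasure lborel C"
    proof (intro emeasure_mono)
      show "X \<union> Y \<subseteq> C"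
      proof
        fix x assume "x \<in> X \<union> Y"
        then show "x \<in> C"
          using C[of "b + 2 * x" b] C[of a "a + (-2) * x"] a b by (auto simp: X_def Y_def)
      qed
    qed simp
    finally show ?thesis by (simp add: mult_left_mono)
  qed
  have "emeasure lborel A + emeasure lborel (B \<inter> {..b}) \<le> 2 * emeasure lborel C" if "b \<in> B" for b
    by (rule emeasure_add_le_if_lower_parts_add_le) (fact assms main[OF _ that])+
  then have "emeasure lborel B + emeasure lborel A \<le> 2 * emeasure lborel C"
    by (intro emeasure_add_le_if_lower_parts_add_le[OF assms(2,5)]) (simp only: add.commute)
  then show ?thesis by (simp only: add.commute)
qed

lemma ennreal_mult_le_power2_if_add_le:
  fixes a b c :: ennreal
  assumes "a + b \<le> 2 * c"
  shows "a * b \<le> c\<^sup>2"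
proof (cases "c = \<infinity>")
  case False
  then obtain z where z: "c = ennreal z" "0 \<le> z" by (cases c) auto
  have 2: "2 * c = ennreal (2 * z)" using z by (simp add: ennreal_mult')
  then have "a + b < \<infinity>" using assms by (metis ennreal_less_top infinity_ennreal_def le_less_trans)
  then obtain x y where xy: "a = ennreal x" "b = ennreal y" "0 \<le> x" "0 \<le> y"
    by (cases a; cases b) auto
  have "x + y \<le> 2 * z" using assms z xy unfolding 2 by (simp flip: ennreal_plus)
  then have "(x + y)\<^sup>2 \<le> (2 * z)\<^sup>2" using xy by (intro power_mono) auto
  moreover have "4 * (x * y) \<le> (x + y)\<^sup>2"
    using zero_le_power2[of "x - y"] by (simp add: power2_eq_square algebra_simps)
  ultimately have "x * y \<le> z\<^sup>2" by (simp add: power2_eq_square)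
  then show ?thesis using z xy by (simp add: ennreal_power flip: ennreal_mult)
qed (simp add: power2_eq_square)

text \<open>Truncating at 1 lets \<open>t\<close> run over \<open>[0, 1)\<close> only. These are the levels on which the superlevel sets
  of functions with supremum 1 are nonempty, as the Brunn-Minkowski inequality demands.\<close>

lemma layer_cake_below_one:
  fixes F :: "real \<Rightarrow> ennreal"
  assumes [measurable]: "F \<in> borel_measurable borel"
  shows "(\<integral>\<^sup>+s. min (F s) 1 \<partial>lborel)
    = (\<integral>\<^sup>+t. indicator {0..<1} t * emeasure lborel {s. ennreal t < F s} \<partial>lborel)"
proof -
  have eq: "min (F s) 1 = (\<integral>\<^sup>+t. indicator {0..<1} t * indicator {s. ennreal t < F s} s \<partial>lborel)" for s
  proof (cases "F s \<ge> 1")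
    case True
    then have "(\<integral>\<^sup>+t. indicator {0..<1} t * indicator {s. ennreal t < F s} s \<partial>lborel)
      = (\<integral>\<^sup>+t. indicator {0..<1::real} t \<partial>lborel)"
      by (intro nn_integral_cong)
        (auto split: split_indicator intro: less_le_trans[rotated] simp: ennreal_less_one_iff)
    then show ?thesis using True by (simp add: min_absorb2)
  next
    case False
    then obtain r where r: "F s = ennreal r" "0 \<le> r" by (cases "F s") auto
    with False have "r < 1" by (simp add: not_le)
    then have "(\<integral>\<^sup>+t. indicator {0..<1} t * indicator {s. ennreal t < F s} s \<partial>lborel)
      = (\<integral>\<^sup>+t. indicator {0..<r} t \<partial>lborel)"
      by (intro nn_integral_cong) (auto split: split_indicator simp: r ennreal_less_iff)
    then show ?thesis using r \<open>r < 1\<close> by (simp add: min_def)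
  qed
  have "(\<integral>\<^sup>+s. min (F s) 1 \<partial>lborel)
    = (\<integral>\<^sup>+s. (\<integral>\<^sup>+t. indicator {0..<1} t * indicator {s. ennreal t < F s} s \<partial>lborel) \<partial>lborel)"
    by (simp only: eq)
  also have "\<dots> = (\<integral>\<^sup>+t. (\<integral>\<^sup>+s. indicator {0..<1} t * indicator {s. ennreal t < F s} s \<partial>lborel) \<partial>lborel)"
    by (rule lborel_pair.Fubini') measurable
  also have "\<dots> = (\<integral>\<^sup>+t. indicator {0..<1} t * emeasure lborel {s. ennreal t < F s} \<partial>lborel)"
    by (intro nn_integral_cong) (simp add: nn_integral_cmult)
  finally show ?thesis .
qed

text \<open>With both suprema equal to 1, the superlevel sets \<open>{f > t}\<close> and \<open>{g > t}\<close> are nonempty for the same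
  levels \<open>t < 1\<close>, and \<open>{h > t}\<close> contains all half differences of their points. Integrating
  Brunn-Minkowski over the levels yields the stronger arithmetic bound
  \<open>\<integral>f + \<integral>g \<le> 2 \<integral>h\<close>.\<close>

lemma Prekopa_Leindler_normalised:
  fixes f g h :: "real \<Rightarrow> ennreal"
  assumes [measurable]: "f \<in> borel_measurable borel" "g \<in> borel_measurable borel" "h \<in> borel_measurable borel"
    and fg: "\<And>s t. f s * g t \<le> (h ((s - t) / 2))\<^sup>2"
    and f: "(SUP s. f s) = 1" and g: "(SUP s. g s) = 1"
  shows "(\<integral>\<^sup>+s. f s \<partial>lborel) * (\<integral>\<^sup>+s. g s \<partial>lborel) \<le> (\<integral>\<^sup>+s. h s \<partial>lborel)\<^sup>2"
proof (rule ennreal_mult_le_power2_if_add_le)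
  have f1: "min (f s) 1 = f s" and g1: "min (g s) 1 = g s" for s
    using SUP_upper[of s UNIV f] SUP_upper[of s UNIV g] f g by (auto simp: min_absorb1)
  have level: "indicator {0..<1} t * emeasure lborel {s. ennreal t < f s}
      + indicator {0..<1} t * emeasure lborel {s. ennreal t < g s}
      \<le> 2 * (indicator {0..<1} t * emeasure lborel {s. ennreal t < h s})" for t :: real
  proof (cases "0 \<le> t \<and> t < 1")
    case True
    have "{s. ennreal t < f s} \<noteq> {}" "{s. ennreal t < g s} \<noteq> {}"
      using True f g less_SUP_iff[of "ennreal t" f UNIV] less_SUP_iff[of "ennreal t" g UNIV]
      by (auto simp: ennreal_less_one_iff)
    moreover have "(a - b) / 2 \<in> {s. ennreal t < h s}" if "a \<in> {s. ennreal t < f s}" "b \<in> {s. ennreal t < g s}" for a b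
    proof (rule ccontr)
      assume "(a - b) / 2 \<notin> {s. ennreal t < h s}"
      then have "(h ((a - b) / 2))\<^sup>2 \<le> (ennreal t)\<^sup>2" by (intro power_mono) auto
      with fg[of a b] have le: "f a * g b \<le> (ennreal t)\<^sup>2" by (rule order_trans)
      have "f a \<le> 1" "g b \<le> 1" using f1[of a] g1[of b] by (metis min.cobounded2)+
      then obtain x y where xy: "f a = ennreal x" "g b = ennreal y" "0 \<le> x" "0 \<le> y"
        by (cases "f a"; cases "g b") (auto simp: top_unique)
      have "t < x" "t < y" using that True xy by (auto simp: ennreal_less_iff)
      then have "t * t < x * y" using True by (intro mult_strict_mono) auto
      with le show False using xy True
        by (simp add: power2_eq_square flip: ennreal_mult)
    qed
    ultimately have "emeasure lborel {s. ennreal t < f s} + emeasure lborel {s. ennreal t < g s}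
        \<le> 2 * emeasure lborel {s. ennreal t < h s}"
      by (intro Brunn_Minkowski_half_difference) measurable
    then show ?thesis using True by simp
  qed auto
  have "(\<integral>\<^sup>+s. f s \<partial>lborel) + (\<integral>\<^sup>+s. g s \<partial>lborel)
      = (\<integral>\<^sup>+s. min (f s) 1 \<partial>lborel) + (\<integral>\<^sup>+s. min (g s) 1 \<partial>lborel)"
    by (simp only: f1 g1)
  also have "\<dots> = (\<integral>\<^sup>+t. indicator {0..<1} t * emeasure lborel {s. ennreal t < f s}
      + indicator {0..<1} t * emeasure lborel {s. ennreal t < g s} \<partial>lborel)"
    by (subst nn_integral_add) (auto simp: layer_cake_below_one)
  also have "\<dots> \<le> (\<integral>\<^sup>+t. 2 * (indicator {0..<1} t * emeasure lborel {s. ennreal t < h s}) \<partial>lborel)"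
    by (intro nn_integral_mono level)
  also have "\<dots> = 2 * (\<integral>\<^sup>+t. indicator {0..<1} t * emeasure lborel {s. ennreal t < h s} \<partial>lborel)"
    by (rule nn_integral_cmult) measurable
  also have "\<dots> = 2 * (\<integral>\<^sup>+s. min (h s) 1 \<partial>lborel)" by (simp add: layer_cake_below_one)
  also have "\<dots> \<le> 2 * (\<integral>\<^sup>+s. h s \<partial>lborel)" by (intro mult_left_mono nn_integral_mono) auto
  finally show "(\<integral>\<^sup>+s. f s \<partial>lborel) + (\<integral>\<^sup>+s. g s \<partial>lborel) \<le> 2 * (\<integral>\<^sup>+s. h s \<partial>lborel)" .
qed

text \<open>Both sides of the hypothesis and of the conclusion scale by \<open>1 / (a b)\<close> when \<open>f\<close>, \<open>g\<close> and \<open>h\<close> are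
  divided by their suprema \<open>a\<close>, \<open>b\<close> and by \<open>sqrt (a b)\<close>; this reduces to suprema 1.\<close>

lemma Prekopa_Leindler_bounded:
  fixes f g h :: "real \<Rightarrow> ennreal"
  assumes [measurable]: "f \<in> borel_measurable borel" "g \<in> borel_measurable borel" "h \<in> borel_measurable borel"
    and fg: "\<And>s t. f s * g t \<le> (h ((s - t) / 2))\<^sup>2"
    and f: "(SUP s. f s) < \<infinity>" and g: "(SUP s. g s) < \<infinity>"
  shows "(\<integral>\<^sup>+s. f s \<partial>lborel) * (\<integral>\<^sup>+s. g s \<partial>lborel) \<le> (\<integral>\<^sup>+s. h s \<partial>lborel)\<^sup>2"
proof (cases "(SUP s. f s) = 0 \<or> (SUP s. g s) = 0")
  case True
  then have "(\<forall>s. f s = 0) \<or> (\<forall>s. g s = 0)"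
    by (metis SUP_upper UNIV_I le_zero_eq)
  then show ?thesis by auto
next
  case False
  obtain a where a: "(SUP s. f s) = ennreal a" "a > 0"
    using False f by (cases "SUP s. f s") auto
  obtain b where b: "(SUP s. g s) = ennreal b" "b > 0"
    using False g by (cases "SUP s. g s") auto
  define c where "c = sqrt (a * b)"
  have c: "c > 0" "c\<^sup>2 = a * b" using a b by (auto simp: c_def)
  have "(\<integral>\<^sup>+s. ennreal (1 / a) * f s \<partial>lborel) * (\<integral>\<^sup>+s. ennreal (1 / b) * g s \<partial>lborel)
      \<le> (\<integral>\<^sup>+s. ennreal (1 / c) * h s \<partial>lborel)\<^sup>2"
  proof (rule Prekopa_Leindler_normalised)
    show "(SUP s. ennreal (1 / a) * f s) = 1" "(SUP s. ennreal (1 / b) * g s) = 1"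
      using a b by (simp_all add: SUP_mult_left_ennreal[symmetric] flip: ennreal_mult)
    fix s t
    have "(ennreal (1 / a) * f s) * (ennreal (1 / b) * g t) = ennreal ((1 / c)\<^sup>2) * (f s * g t)"
      using a b c by (simp add: power_divide ennreal_mult' mult_ac flip: divide_divide_eq_left) (simp add: ennreal_mult[symmetric] mult_ac flip: mult.assoc)
    also have "\<dots> \<le> ennreal ((1 / c)\<^sup>2) * (h ((s - t) / 2))\<^sup>2"
      by (intro mult_left_mono fg) simp
    also have "\<dots> = (ennreal (1 / c) * h ((s - t) / 2))\<^sup>2"
      using c by (simp add: power_mult_distrib ennreal_power)
    finally show "ennreal (1 / a) * f s * (ennreal (1 / b) * g t) \<le> (ennreal (1 / c) * h ((s - t) / 2))\<^sup>2" .
  qed measurable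
  then have "ennreal (1 / a) * ennreal (1 / b) * ((\<integral>\<^sup>+s. f s \<partial>lborel) * (\<integral>\<^sup>+s. g s \<partial>lborel))
      \<le> ennreal ((1 / c)\<^sup>2) * (\<integral>\<^sup>+s. h s \<partial>lborel)\<^sup>2"
    using c by (simp add: nn_integral_cmult power_mult_distrib ennreal_power)
      (simp only: mult_ac)
  also have "ennreal (1 / a) * ennreal (1 / b) = ennreal ((1 / c)\<^sup>2)"
    using a b c by (simp add: power_divide flip: ennreal_mult)
  finally have "ennreal (c\<^sup>2) * (ennreal ((1 / c)\<^sup>2) * ((\<integral>\<^sup>+s. f s \<partial>lborel) * (\<integral>\<^sup>+s. g s \<partial>lborel)))
      \<le> ennreal (c\<^sup>2) * (ennreal ((1 / c)\<^sup>2) * (\<integral>\<^sup>+s. h s \<partial>lborel)\<^sup>2)"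
    by (rule mult_left_mono) simp
  moreover have "ennreal (c\<^sup>2) * ennreal ((1 / c)\<^sup>2) = 1"
    using c(1) by (simp add: power_divide flip: ennreal_mult)
  ultimately show ?thesis by (simp flip: mult.assoc)
qed

lemma nn_integral_eq_SUP_truncations:
  fixes f :: "real \<Rightarrow> ennreal"
  assumes [measurable]: "f \<in> borel_measurable borel"
  shows "(\<integral>\<^sup>+s. f s \<partial>lborel) = (SUP n::nat. \<integral>\<^sup>+s. min (f s) (of_nat n) \<partial>lborel)"
proof -
  have "f s = (SUP n::nat. min (f s) (of_nat n))" for s
    using inf_SUP[of "f s" "\<lambda>n::nat. of_nat n" UNIV] ennreal_SUP_of_nat_eq_top
    by (simp add: inf_min)
  then have "(\<integral>\<^sup>+s. f s \<partial>lborel) = (\<integral>\<^sup>+s. (SUP n::nat. min (f s) (of_nat n)) \<partial>lborel)"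
    by presburger
  also have "\<dots> = (SUP n::nat. \<integral>\<^sup>+s. min (f s) (of_nat n) \<partial>lborel)"
    by (rule nn_integral_monotone_convergence_SUP)
      (auto simp: incseq_def le_fun_def min_le_iff_disj intro: le_infI2 min.coboundedI2 of_nat_mono)
  finally show ?thesis .
qed

text \<open>The midpoint \<open>(s + t) / 2\<close> of the usual formulation is replaced by \<open>(s - t) / 2\<close>. Symmetrising the polar
  body compares a section with the reflection of another one; in this form the reflection is
  part of the inequality.\<close>

lemma Prekopa_Leindler_half_difference:
  fixes f g h :: "real \<Rightarrow> ennreal"
  assumes [measurable]: "f \<in> borel_measurable borel" "g \<in> borel_measurable borel" "h \<in> borel_measurable borel"
    and fg: "\<And>s t. f s * g t \<le> (h ((s - t) / 2))\<^sup>2"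
  shows "(\<integral>\<^sup>+s. f s \<partial>lborel) * (\<integral>\<^sup>+s. g s \<partial>lborel) \<le> (\<integral>\<^sup>+s. h s \<partial>lborel)\<^sup>2"
proof -
  have le: "(\<integral>\<^sup>+s. min (f s) (of_nat m) \<partial>lborel) * (\<integral>\<^sup>+s. min (g s) (of_nat n) \<partial>lborel)
      \<le> (\<integral>\<^sup>+s. h s \<partial>lborel)\<^sup>2" for m n :: nat
  proof (rule Prekopa_Leindler_bounded)
    show "(SUP s. min (f s) (of_nat m)) < \<infinity>" "(SUP s. min (g s) (of_nat n)) < \<infinity>"
      by (rule le_less_trans[OF SUP_least], rule min.cobounded2, simp add: of_nat_less_top)+
    show "min (f s) (of_nat m) * min (g t) (of_nat n) \<le> (h ((s - t) / 2))\<^sup>2" for s t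
      by (rule order_trans[OF mult_mono fg]) auto
  qed measurable
  show ?thesis
    unfolding nn_integral_eq_SUP_truncations[OF assms(1)] nn_integral_eq_SUP_truncations[OF assms(2)]
    by (simp add: SUP_mult_left_ennreal SUP_mult_right_ennreal le SUP_least)
qed

section \<open>Coordinatewise geometric means\<close>

text \<open>Both sides integrate \<open>f\<close> against the same Borel measure; equality of the two measures is tested on
  the intersections with \<open>[exp (-n), exp n]\<close>, where the substitution rule for compact intervals
  applies.\<close>

lemma nn_integral_positive_reals_exp:
  fixes f :: "real \<Rightarrow> ennreal"
  assumes [measurable]: "f \<in> borel_measurable borel"
  shows "(\<integral>\<^sup>+s. indicator {0<..} s * f s \<partial>lborel) = (\<integral>\<^sup>+u. ennreal (exp u) * f (exp u) \<partial>lborel)"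
proof -
  have eq: "density lborel (indicator {0<..}) = distr (density lborel (\<lambda>u. ennreal (exp u))) borel exp"
    (is "?L = ?R")
  proof (rule measure_eqI)
    fix A assume "A \<in> sets ?L"
    then have [measurable]: "A \<in> sets borel" by simp
    have inc: "{exp (- real m)..exp (real m)} \<subseteq> {exp (- real n)..exp (real n)}"
        "{- real m..real m} \<subseteq> {- real n..real n}" if "m \<le> n" for m n
      using that by auto
    have un: "(\<Union>n::nat. {exp (- real n)..exp (real n)}) = {0<..}"
    proof (intro equalityI subsetI)
      fix x :: real assume "x \<in> {0<..}"
      then obtain y where y: "x = exp y" by (metis exp_ln greaterThan_iff)
      obtain n :: nat where "\<bar>y\<bar> \<le> real n" using real_arch_simple by blast
      then show "x \<in> (\<Union>n::nat. {exp (- real n)..exp (real n)})" using y by (intro UN_I[of n]) auto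
    qed (auto intro: less_le_trans[OF exp_gt_zero])
    have un': "(\<Union>n::nat. {- real n..real n}) = UNIV"
    proof (intro equalityI subsetI)
      fix y :: real
      obtain n :: nat where "\<bar>y\<bar> \<le> real n" using real_arch_simple by blast
      then show "y \<in> (\<Union>n::nat. {- real n..real n})" by (intro UN_I[of n]) auto
    qed auto
    have trunc: "emeasure ?L (A \<inter> {exp (- real n)..exp (real n)})
        = emeasure (density lborel (\<lambda>u. ennreal (exp u))) (exp -` A \<inter> {- real n..real n})" for n :: nat
    proof -
      have pos: "x > 0" if "exp (- real n) \<le> x" for x :: real
        using that by (meson exp_gt_zero less_le_trans)
      have "emeasure ?L (A \<inter> {exp (- real n)..exp (real n)})
          = (\<integral>\<^sup>+s. ennreal (indicator A s * indicator {exp (- real n)..exp (real n)} s) \<partial>lborel)"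
        by (subst emeasure_density) (auto intro!: nn_integral_cong split: split_indicator dest: pos)
      also have "\<dots> = (\<integral>\<^sup>+u. ennreal (indicator A (exp u) * exp u * indicator {- real n..real n} u) \<partial>lborel)"
        by (rule nn_integral_substitution)
          (auto intro!: derivative_eq_intros continuous_intros simp: set_borel_measurable_def)
      also have "\<dots> = emeasure (density lborel (\<lambda>u. ennreal (exp u))) (exp -` A \<inter> {- real n..real n})"
        by (subst emeasure_density) (auto intro!: nn_integral_cong split: split_indicator)
      finally show ?thesis .
    qed
    have "emeasure ?L A = emeasure ?L (A \<inter> {0<..})"
      by (subst (1 2) emeasure_density) (auto intro!: nn_integral_cong split: split_indicator)
    also have "\<dots> = emeasure ?L (\<Union>n::nat. A \<inter> {exp (- real n)..exp (real n)})"
      by (simp add: un flip: Int_UN_distrib)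
    also have "\<dots> = (SUP n::nat. emeasure ?L (A \<inter> {exp (- real n)..exp (real n)}))"
    proof (intro SUP_emeasure_incseq[symmetric])
      show "incseq (\<lambda>n::nat. A \<inter> {exp (- real n)..exp (real n)})"
        unfolding incseq_def by (intro allI impI Int_mono order_refl inc)
    qed auto
    also have "\<dots> = (SUP n::nat. emeasure (density lborel (\<lambda>u. ennreal (exp u))) (exp -` A \<inter> {- real n..real n}))"
      by (simp only: trunc)
    also have "\<dots> = emeasure (density lborel (\<lambda>u. ennreal (exp u))) (\<Union>n::nat. exp -` A \<inter> {- real n..real n})"
    proof (intro SUP_emeasure_incseq)
      show "incseq (\<lambda>n::nat. exp -` A \<inter> {- real n..real n})"
        unfolding incseq_def by (intro allI impI Int_mono order_refl inc)
    qed auto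
    also have "\<dots> = emeasure ?R A"
      by (subst emeasure_distr) (auto simp: un' simp flip: Int_UN_distrib)
    finally show "emeasure ?L A = emeasure ?R A" .
  qed simp
  have "(\<integral>\<^sup>+s. indicator {0<..} s * f s \<partial>lborel) = (\<integral>\<^sup>+s. f s \<partial>?L)"
    by (subst nn_integral_density) auto
  also have "\<dots> = (\<integral>\<^sup>+u. ennreal (exp u) * f (exp u) \<partial>lborel)"
    unfolding eq by (subst nn_integral_distr) (auto simp: nn_integral_density)
  finally show ?thesis .
qed

text \<open>The substitutions \<open>s = exp u\<close> and \<open>t = exp (-v)\<close> turn geometric means into half differences: if
  \<open>r^2 = s t\<close>, then \<open>r = exp ((u - v) / 2)\<close>. The sign in \<open>t = exp (-v)\<close> serves this purpose, and the
  Jacobians \<open>exp u\<close> and \<open>exp (-v)\<close> multiply to the square of the Jacobian at \<open>(u - v) / 2\<close>.\<close>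

lemma Prekopa_Leindler_geometric_mean_positive:
  fixes f g h :: "real \<Rightarrow> ennreal"
  assumes [measurable]: "f \<in> borel_measurable borel" "g \<in> borel_measurable borel" "h \<in> borel_measurable borel"
    and fg: "\<And>s t r. 0 < s \<Longrightarrow> 0 < t \<Longrightarrow> 0 < r \<Longrightarrow> r\<^sup>2 = s * t \<Longrightarrow> f s * g t \<le> (h r)\<^sup>2"
  shows "(\<integral>\<^sup>+s. indicator {0<..} s * f s \<partial>lborel) * (\<integral>\<^sup>+s. indicator {0<..} s * g s \<partial>lborel)
    \<le> (\<integral>\<^sup>+s. indicator {0<..} s * h s \<partial>lborel)\<^sup>2"
proof -
  define G where "G u = ennreal (exp u) * g (exp u)" for u :: real
  have [measurable]: "G \<in> borel_measurable borel" unfolding G_def by measurable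
  have "(\<integral>\<^sup>+u. ennreal (exp u) * f (exp u) \<partial>lborel) * (\<integral>\<^sup>+v. G (- v) \<partial>lborel)
    \<le> (\<integral>\<^sup>+u. ennreal (exp u) * h (exp u) \<partial>lborel)\<^sup>2"
  proof (rule Prekopa_Leindler_half_difference)
    fix s t :: real
    have "f (exp s) * g (exp (- t)) \<le> (h (exp ((s - t) / 2)))\<^sup>2"
      by (rule fg) (auto simp: power2_eq_square simp flip: exp_add)
    then have "(ennreal (exp s) * ennreal (exp (- t))) * (f (exp s) * g (exp (- t)))
        \<le> (ennreal (exp s) * ennreal (exp (- t))) * (h (exp ((s - t) / 2)))\<^sup>2"
      by (rule mult_left_mono) simp
    moreover have "(ennreal (exp ((s - t) / 2)))\<^sup>2 = ennreal (exp s) * ennreal (exp (- t))"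
      by (simp add: power2_eq_square flip: ennreal_mult exp_add)
    ultimately show "ennreal (exp s) * f (exp s) * G (- t) \<le> (ennreal (exp ((s - t) / 2)) * h (exp ((s - t) / 2)))\<^sup>2"
      unfolding G_def power_mult_distrib by (simp only: mult_ac)
  qed measurable
  moreover have "(\<integral>\<^sup>+v. G (- v) \<partial>lborel) = (\<integral>\<^sup>+v. G v \<partial>lborel)"
    using nn_integral_real_affine[of G "-1" 0] by simp
  ultimately show ?thesis
    by (simp add: nn_integral_positive_reals_exp G_def)
qed

lemma nn_integral_split_at_zero:
  fixes f :: "real \<Rightarrow> ennreal"
  assumes [measurable]: "f \<in> borel_measurable borel"
  shows "(\<integral>\<^sup>+s. f s \<partial>lborel)
    = (\<integral>\<^sup>+s. indicator {0<..} s * f s \<partial>lborel) + (\<integral>\<^sup>+s. indicator {0<..} s * f (- s) \<partial>lborel)"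
proof -
  have "(\<integral>\<^sup>+s. f s \<partial>lborel) = (\<integral>\<^sup>+s. indicator {0<..} s * f s + indicator {..<0} s * f s \<partial>lborel)"
    by (intro nn_integral_cong_AE eventually_mono[OF AE_lborel_singleton[of 0]])
      (auto split: split_indicator)
  also have "\<dots> = (\<integral>\<^sup>+s. indicator {0<..} s * f s \<partial>lborel) + (\<integral>\<^sup>+s. indicator {..<0} s * f s \<partial>lborel)"
    by (rule nn_integral_add) measurable
  also have "(\<integral>\<^sup>+s. indicator {..<0} s * f s \<partial>lborel) = (\<integral>\<^sup>+s. indicator {..<0} (- s) * f (- s) \<partial>lborel)"
    using nn_integral_real_affine[of "\<lambda>s. indicator {..<0} s * f s" "-1" 0] by simp
  also have "(\<lambda>s::real. indicator {..<0} (- s) * f (- s)) = (\<lambda>s. indicator {0<..} s * f (- s))"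
    by (auto split: split_indicator)
  finally show ?thesis .
qed

text \<open>Each of the four products of half-line integrals of \<open>f\<close> and \<open>g\<close> is bounded by the square of either
  half-line integral of \<open>h\<close>, hence by the square of the smaller one; four times that square is at
  most \<open>(\<integral>h)^2\<close>. The hypothesis involves \<open>r\<close> only through \<open>r^2\<close>, so \<open>h\<close> is bounded below on both half-lines.
  Integrals over the whole line become integrals over the whole space, not over an orthant, when the
  number of variables grows.\<close>

lemma Prekopa_Leindler_geometric_mean:
  fixes f g h :: "real \<Rightarrow> ennreal"
  assumes [measurable]: "f \<in> borel_measurable borel" "g \<in> borel_measurable borel" "h \<in> borel_measurable borel"
    and fg: "\<And>s t r. r\<^sup>2 = \<bar>s * t\<bar> \<Longrightarrow> f s * g t \<le> (h r)\<^sup>2"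
  shows "(\<integral>\<^sup>+s. f s \<partial>lborel) * (\<integral>\<^sup>+s. g s \<partial>lborel) \<le> (\<integral>\<^sup>+s. h s \<partial>lborel)\<^sup>2"
proof -
  define I where "I F \<sigma> = (\<integral>\<^sup>+s. indicator {0<..} s * F (\<sigma> * s) \<partial>lborel)" for F :: "real \<Rightarrow> ennreal" and \<sigma> :: real
  have split: "(\<integral>\<^sup>+s. F s \<partial>lborel) = I F 1 + I F (-1)" if "F \<in> borel_measurable borel" for F
    using nn_integral_split_at_zero[OF that] by (simp add: I_def)
  have le: "I f a * I g b \<le> (I h c)\<^sup>2" if "a \<in> {1, -1}" "b \<in> {1, -1}" "c \<in> {1, -1}" for a b c
    unfolding I_def
  proof (rule Prekopa_Leindler_geometric_mean_positive)
    show "f (a * s) * g (b * t) \<le> (h (c * r))\<^sup>2" if "0 < s" "0 < t" "r\<^sup>2 = s * t" for s t r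
      using that \<open>a \<in> {1, -1}\<close> \<open>b \<in> {1, -1}\<close> \<open>c \<in> {1, -1}\<close>
      by (intro fg) (auto simp: power_mult_distrib)
  qed measurable
  \<comment> \<open>the smaller of the two half-line integrals of \<open>h\<close>\<close>
  define m where "m = min (I h 1) (I h (-1))"
  have m: "I f a * I g b \<le> m\<^sup>2" if "a \<in> {1, -1}" "b \<in> {1, -1}" for a b
    using le[OF that, of 1] le[OF that, of "-1"] by (simp add: m_def min_def)
  have "(I f 1 + I f (-1)) * (I g 1 + I g (-1))
      = I f 1 * I g 1 + I f 1 * I g (-1) + (I f (-1) * I g 1 + I f (-1) * I g (-1))"
    by (simp add: distrib_left distrib_right add_ac)
  also have "\<dots> \<le> m\<^sup>2 + m\<^sup>2 + (m\<^sup>2 + m\<^sup>2)"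
    by (intro add_mono m) auto
  also have "\<dots> = (m + m)\<^sup>2" by (simp add: power2_eq_square distrib_left distrib_right)
  also have "\<dots> \<le> (I h 1 + I h (-1))\<^sup>2"
    by (intro power_mono add_mono) (auto simp: m_def)
  finally show ?thesis by (simp add: split)
qed

section \<open>Passage to several variables\<close>

text \<open>A relation, rather than a function giving \<open>r\<close> from \<open>s\<close> and \<open>t\<close>, is needed to include both square roots
  \<open>r\<close> of \<open>\<bar>s * t\<bar>\<close>.\<close>

definition Prekopa_Leindler_relation :: "(real \<Rightarrow> real \<Rightarrow> real \<Rightarrow> bool) \<Rightarrow> bool" where
  "Prekopa_Leindler_relation R \<longleftrightarrow>
    (\<forall>f \<in> borel_measurable borel. \<forall>g \<in> borel_measurable borel. \<forall>h \<in> borel_measurable borel.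
      (\<forall>s t r. R s t r \<longrightarrow> f s * g t \<le> (h r :: ennreal)\<^sup>2) \<longrightarrow>
      (\<integral>\<^sup>+s. f s \<partial>lborel) * (\<integral>\<^sup>+s. g s \<partial>lborel) \<le> (\<integral>\<^sup>+s. h s \<partial>lborel)\<^sup>2)"

lemma Prekopa_Leindler_relation_half_difference:
  "Prekopa_Leindler_relation (\<lambda>s t r. r = (s - t) / 2)"
  unfolding Prekopa_Leindler_relation_def
  by (intro ballI impI Prekopa_Leindler_half_difference) auto

lemma Prekopa_Leindler_relation_geometric_mean:
  "Prekopa_Leindler_relation (\<lambda>s t r. r\<^sup>2 = \<bar>s * t\<bar>)"
  unfolding Prekopa_Leindler_relation_def
  by (intro ballI impI Prekopa_Leindler_geometric_mean) auto

interpretation lborel_product: product_sigma_finite "\<lambda>_. lborel :: real measure"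
  by unfold_locales

text \<open>Integrating out all coordinates but \<open>i\<close> gives, by the induction hypothesis, three functions of one
  variable that again satisfy the hypothesis of the one-dimensional inequality. The product
  \<open>f x * g y\<close> against a square is the form of the inequality that reproduces itself in this way.\<close>

lemma Prekopa_Leindler_tensorise:
  fixes f g h :: "('i \<Rightarrow> real) \<Rightarrow> ennreal"
  assumes R: "Prekopa_Leindler_relation R" and "finite I"
    and "f \<in> borel_measurable (Pi\<^sub>M I (\<lambda>_. lborel))"
    and "g \<in> borel_measurable (Pi\<^sub>M I (\<lambda>_. lborel))"
    and "h \<in> borel_measurable (Pi\<^sub>M I (\<lambda>_. lborel))"
    and "\<And>x y z. \<forall>i\<in>I. R (x i) (y i) (z i) \<Longrightarrow> f x * g y \<le> (h z)\<^sup>2"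
  shows "(\<integral>\<^sup>+x. f x \<partial>Pi\<^sub>M I (\<lambda>_. lborel)) * (\<integral>\<^sup>+x. g x \<partial>Pi\<^sub>M I (\<lambda>_. lborel))
    \<le> (\<integral>\<^sup>+x. h x \<partial>Pi\<^sub>M I (\<lambda>_. lborel))\<^sup>2"
  using assms(2-)
proof (induction I arbitrary: f g h rule: finite_induct)
  case empty
  have "(\<integral>\<^sup>+x. k x \<partial>Pi\<^sub>M {} (\<lambda>_. lborel :: real measure)) = k (\<lambda>_. undefined)" for k :: "('i \<Rightarrow> real) \<Rightarrow> ennreal"
    by (rule lborel_product.nn_integral_empty) simp
  then show ?case using empty.prems(4) by simp
next
  case (insert i I)
  note [measurable] = insert.prems(1-3)
  define F where "F f s = (\<integral>\<^sup>+x. f (x(i := s)) \<partial>Pi\<^sub>M I (\<lambda>_. lborel))" for f :: "('i \<Rightarrow> real) \<Rightarrow> ennreal" and s :: real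
  interpret sigma_finite_measure "Pi\<^sub>M I (\<lambda>_. lborel :: real measure)"
    by (rule lborel_product.sigma_finite) fact
  have F_meas: "F k \<in> borel_measurable borel"
    if [measurable]: "k \<in> borel_measurable (Pi\<^sub>M (insert i I) (\<lambda>_. lborel))" for k
    unfolding F_def by measurable
  have F: "(\<integral>\<^sup>+x. k x \<partial>Pi\<^sub>M (insert i I) (\<lambda>_. lborel)) = (\<integral>\<^sup>+s. F k s \<partial>lborel)"
    if "k \<in> borel_measurable (Pi\<^sub>M (insert i I) (\<lambda>_. lborel))" for k
    unfolding F_def using insert.hyps that by (rule lborel_product.product_nn_integral_insert_rev)
  have "F f s * F g t \<le> (F h r)\<^sup>2" if "R s t r" for s t r
    unfolding F_def
  proof (rule insert.IH)
    fix x y z :: "'i \<Rightarrow> real" assume "\<forall>j\<in>I. R (x j) (y j) (z j)"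
    then show "f (x(i := s)) * g (y(i := t)) \<le> (h (z(i := r)))\<^sup>2"
      using that insert.hyps by (intro insert.prems(4)) auto
  qed measurable
  then show ?case
    unfolding F[OF insert.prems(1)] F[OF insert.prems(2)] F[OF insert.prems(3)]
    using R[unfolded Prekopa_Leindler_relation_def] F_meas insert.prems(1-3) by blast
qed

section \<open>Coordinates and integration in Euclidean space\<close>

definition coord_upd :: "'n \<Rightarrow> real ^ 'n \<Rightarrow> real \<Rightarrow> real ^ 'n::finite" where
  "coord_upd i x s = (\<chi> j. if j = i then s else x $ j)"

lemma coord_upd_nth [simp]: "coord_upd i x s $ j = (if j = i then s else x $ j)"
  by (simp add: coord_upd_def)

lemma coord_upd_coord_upd [simp]: "coord_upd i (coord_upd i x s) t = coord_upd i x t"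
  by (simp add: vec_eq_iff)

lemma coord_upd_self: "coord_upd i x (x $ i) = x"
  by (simp add: vec_eq_iff)

lemma coord_upd_commute: "i \<noteq> j \<Longrightarrow> coord_upd i (coord_upd j x t) s = coord_upd j (coord_upd i x s) t"
  by (simp add: vec_eq_iff)

lemma coord_upd_vec_lambda: "coord_upd i (vec_lambda y) s = vec_lambda (y(i := s))"
  by (simp add: vec_eq_iff)

lemma coord_upd_combination:
  "coord_upd i (a *\<^sub>R x + b *\<^sub>R y) (a * s + b * t) = a *\<^sub>R coord_upd i x s + b *\<^sub>R coord_upd i y t"
  by (simp add: vec_eq_iff)

lemma coord_upd_uminus: "coord_upd i (- x) (- s) = - coord_upd i x s"
  by (simp add: vec_eq_iff)

lemma inner_coord_upd: "coord_upd i x s \<bullet> coord_upd i y t = (\<Sum>j\<in>UNIV - {i}. x $ j * y $ j) + s * t"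
proof -
  have "coord_upd i x s \<bullet> coord_upd i y t = (\<Sum>j\<in>insert i (UNIV - {i}). coord_upd i x s $ j * coord_upd i y t $ j)"
    by (simp add: inner_vec_def insert_absorb)
  also have "\<dots> = s * t + (\<Sum>j\<in>UNIV - {i}. x $ j * y $ j)"
    by (subst sum.insert) (auto intro!: sum.cong)
  finally show ?thesis by simp
qed

lemma measurable_coord_upd [measurable (raw)]:
  fixes f :: "'a \<Rightarrow> real ^ 'n"
  assumes [measurable]: "f \<in> borel_measurable M" "g \<in> borel_measurable M"
  shows "(\<lambda>w. coord_upd i (f w) (g w)) \<in> borel_measurable M"
proof (rule borel_measurable_euclidean_space[THEN iffD2], rule ballI)
  fix b :: "real ^ 'n" assume "b \<in> Basis"
  then obtain j where b: "b = axis j 1" by (auto simp: Basis_vec_def)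
  have "(\<lambda>w. f w \<bullet> axis j 1) \<in> borel_measurable M" by measurable
  then show "(\<lambda>w. coord_upd i (f w) (g w) \<bullet> b) \<in> borel_measurable M"
    by (cases "j = i") (auto simp: b inner_axis)
qed

lemma measurable_vec_lambda:
  "(vec_lambda :: ('n \<Rightarrow> real) \<Rightarrow> real ^ 'n) \<in> borel_measurable (Pi\<^sub>M UNIV (\<lambda>_. lborel))"
proof (rule borel_measurable_euclidean_space[THEN iffD2], rule ballI)
  fix b :: "real ^ 'n" assume "b \<in> Basis"
  then obtain j where b: "b = axis j 1" by (auto simp: Basis_vec_def)
  have "(\<lambda>w::'n \<Rightarrow> real. w j) \<in> borel_measurable (Pi\<^sub>M UNIV (\<lambda>_. lborel))" by measurable
  then show "(\<lambda>w. vec_lambda w \<bullet> b) \<in> borel_measurable (Pi\<^sub>M UNIV (\<lambda>_. lborel))"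
    by (simp add: b inner_axis)
qed

lemma lborel_vec_eq_distr_PiM:
  "(lborel :: (real ^ 'n) measure) = distr (Pi\<^sub>M UNIV (\<lambda>_. lborel)) borel vec_lambda"
proof (rule lborel_eqI)
  fix l u :: "real ^ 'n" assume le: "\<And>b. b \<in> Basis \<Longrightarrow> l \<bullet> b \<le> u \<bullet> b"
  have le': "l $ i \<le> u $ i" for i
    using le[of "axis i 1"] by (simp add: inner_axis axis_in_Basis_iff)
  have "vec_lambda -` box l u \<inter> space (Pi\<^sub>M UNIV (\<lambda>_. lborel)) = (\<Pi>\<^sub>E i\<in>UNIV. {l $ i<..<u $ i})"
    by (auto simp: space_PiM mem_box_cart PiE_iff)
  then have "emeasure (distr (Pi\<^sub>M UNIV (\<lambda>_. lborel)) borel vec_lambda) (box l u)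
      = emeasure (Pi\<^sub>M UNIV (\<lambda>_. lborel)) (\<Pi>\<^sub>E i\<in>UNIV. {l $ i<..<u $ i})"
    by (simp add: emeasure_distr measurable_vec_lambda)
  also have "\<dots> = (\<Prod>i\<in>UNIV. emeasure lborel {l $ i<..<u $ i})"
    by (rule lborel_product.emeasure_PiM) auto
  also have "\<dots> = ennreal (\<Prod>i\<in>UNIV. (u - l) $ i)"
    using le' by (simp add: prod_ennreal)
  also have "(\<Prod>i\<in>UNIV. (u - l) $ i) = (\<Prod>b\<in>Basis. (u - l) \<bullet> b)"
  proof -
    have "Basis = range (\<lambda>i::'n. axis i (1::real))" by (auto simp: Basis_vec_def)
    then have "(\<Prod>b\<in>Basis. (u - l) \<bullet> b) = (\<Prod>b\<in>range (\<lambda>i::'n. axis i (1::real)). (u - l) \<bullet> b)"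
      by presburger
    also have "\<dots> = (\<Prod>i\<in>UNIV. (u - l) $ i)"
      by (subst prod.reindex) (simp_all add: inj_on_def axis_eq_axis inner_axis)
    finally show ?thesis ..
  qed
  finally show "emeasure (distr (Pi\<^sub>M UNIV (\<lambda>_. lborel)) borel vec_lambda) (box l u)
      = ennreal (\<Prod>b\<in>Basis. (u - l) \<bullet> b)" .
qed simp

lemma nn_integral_vec:
  fixes F :: "real ^ 'n \<Rightarrow> ennreal"
  assumes [measurable]: "F \<in> borel_measurable borel"
  shows "(\<integral>\<^sup>+x. F x \<partial>lborel) = (\<integral>\<^sup>+y. F (vec_lambda y) \<partial>Pi\<^sub>M UNIV (\<lambda>_. lborel))"
  unfolding lborel_vec_eq_distr_PiM using measurable_vec_lambda by (intro nn_integral_distr) auto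

text \<open>Fubini's theorem for one distinguished coordinate. The volume of \<open>K\<close> is computed from its sections along
  the axis \<open>i\<close>, that of the polar from its sections orthogonal to it, hence the two orders of
  integration.\<close>

lemma
  fixes F :: "real ^ 'n \<Rightarrow> ennreal"
  assumes F: "F \<in> borel_measurable borel"
  shows nn_integral_vec_coord_inside:
      "(\<integral>\<^sup>+x. F x \<partial>lborel)
        = (\<integral>\<^sup>+y. (\<integral>\<^sup>+s. F (vec_lambda (y(i := s))) \<partial>lborel) \<partial>Pi\<^sub>M (UNIV - {i}) (\<lambda>_. lborel))" (is ?inside)
    and nn_integral_vec_coord_outside:
      "(\<integral>\<^sup>+x. F x \<partial>lborel)
        = (\<integral>\<^sup>+s. (\<integral>\<^sup>+y. F (vec_lambda (y(i := s))) \<partial>Pi\<^sub>M (UNIV - {i}) (\<lambda>_. lborel)) \<partial>lborel)" (is ?outside)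
proof -
  have ins: "insert i (UNIV - {i}) = UNIV" by auto
  have "(\<lambda>y. F (vec_lambda y)) \<in> borel_measurable (Pi\<^sub>M UNIV (\<lambda>_. lborel))"
    using measurable_vec_lambda F by (rule measurable_compose)
  then have "(\<lambda>y. F (vec_lambda y)) \<in> borel_measurable (Pi\<^sub>M (insert i (UNIV - {i})) (\<lambda>_. lborel))"
    by (simp only: ins)
  note * = lborel_product.product_nn_integral_insert[OF _ _ this]
    lborel_product.product_nn_integral_insert_rev[OF _ _ this]
  show ?inside ?outside
    unfolding nn_integral_vec[OF F] using * by (simp_all add: ins)
qed

lemma measurable_vec_lambda_coord:
  fixes F :: "real ^ 'n \<Rightarrow> ennreal"
  assumes F: "F \<in> borel_measurable borel"
  shows "(\<lambda>y. F (vec_lambda (y(i := s)))) \<in> borel_measurable (Pi\<^sub>M (UNIV - {i}) (\<lambda>_. lborel))"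
proof -
  have ins: "insert i (UNIV - {i}) = UNIV" by auto
  have "(\<lambda>y. y(i := s)) \<in> measurable (Pi\<^sub>M (UNIV - {i}) (\<lambda>_. lborel)) (Pi\<^sub>M (insert i (UNIV - {i})) (\<lambda>_. lborel :: real measure))"
    by measurable
  then have "(\<lambda>y. y(i := s)) \<in> measurable (Pi\<^sub>M (UNIV - {i}) (\<lambda>_. lborel)) (Pi\<^sub>M UNIV (\<lambda>_. lborel :: real measure))"
    by (simp only: ins)
  then show ?thesis
    using measurable_compose[OF measurable_compose[OF _ measurable_vec_lambda] F] by blast
qed

section \<open>Steiner symmetrisation along a coordinate\<close>

definition polar :: "'a::real_inner set \<Rightarrow> 'a set" where
  "polar K = {x. \<forall>y\<in>K. x \<bullet> y \<le> 1}"

text \<open>Each segment cut out of \<open>K\<close> by a line parallel to the axis \<open>i\<close> is replaced by the centred open segment of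
  the same length. Expressing the length by two points \<open>s'\<close>, \<open>s\<close> of \<open>K\<close> on the line, instead of by a measure,
  makes convexity, symmetry and the behaviour of the polar accessible to elementary
  computations. For convex \<open>K\<close> both descriptions agree.\<close>

definition steiner :: "'n \<Rightarrow> (real ^ 'n::finite) set \<Rightarrow> (real ^ 'n) set" where
  "steiner i K = {x. \<exists>s s'. coord_upd i x s \<in> K \<and> coord_upd i x s' \<in> K \<and> 2 * \<bar>x $ i\<bar> < s - s'}"

text \<open>Convexity rules out gaps between \<open>s'\<close> and \<open>s\<close>. For unbounded \<open>S\<close> both sides hold, the length
  being infinite.\<close>

lemma less_emeasure_interval_iff:
  fixes S :: "real set"
  assumes [measurable]: "S \<in> sets borel" and "convex S" and "0 \<le> c"
  shows "(\<exists>s s'. s \<in> S \<and> s' \<in> S \<and> c < s - s') \<longleftrightarrow> ennreal c < emeasure lborel S"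
proof
  assume "\<exists>s s'. s \<in> S \<and> s' \<in> S \<and> c < s - s'"
  then obtain s s' where s: "s \<in> S" "s' \<in> S" "c < s - s'" by auto
  then have "{s'..s} \<subseteq> S"
    using \<open>convex S\<close> by (metis closed_segment_subset closed_segment_eq_real_ivl1 diff_gt_0_iff_gt dual_order.strict_trans2 less_imp_le \<open>0 \<le> c\<close>)
  then have "emeasure lborel {s'..s} \<le> emeasure lborel S" by (intro emeasure_mono) auto
  moreover have "ennreal c < emeasure lborel {s'..s}"
    using s \<open>0 \<le> c\<close> by (simp add: ennreal_lessI)
  ultimately show "ennreal c < emeasure lborel S" by (rule less_le_trans[rotated])
next
  assume less: "ennreal c < emeasure lborel S"
  show "\<exists>s s'. s \<in> S \<and> s' \<in> S \<and> c < s - s'"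
  proof (rule ccontr)
    assume no: "\<not> ?thesis"
    have ne: "S \<noteq> {}" using less by auto
    have le: "s - c \<le> s'" if "s \<in> S" "s' \<in> S" for s s'
      using no that by (force simp: not_less)
    obtain s where "s \<in> S" using ne by auto
    then have "bdd_below S" using le by (auto simp: bdd_below_def)
    moreover have "s' - c \<le> Inf S" if "s' \<in> S" for s'
      using le that ne by (intro cInf_greatest) auto
    ultimately have "S \<subseteq> {Inf S..Inf S + c}"
      by (auto simp: diff_le_eq intro: cInf_lower)
    then have "emeasure lborel S \<le> emeasure lborel {Inf S..Inf S + c}" by (intro emeasure_mono) auto
    then show False using less \<open>0 \<le> c\<close> by simp
  qed
qed

lemma emeasure_symmetric_interval_of_length:
  "emeasure lborel {s::real. ennreal (2 * \<bar>s\<bar>) < e} = e"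
proof (cases e)
  case (real r)
  then have "{s::real. ennreal (2 * \<bar>s\<bar>) < e} = {- (r / 2)<..<r / 2}"
    by (auto simp: ennreal_less_iff)
  then show ?thesis using real by simp
qed simp

text \<open>Membership in the symmetrised set is a measurable condition on the length of a section, and the set of
  \<open>s\<close> with \<open>2 \<bar>s\<bar>\<close> below that length has exactly that length as its measure.\<close>

lemma
  fixes K :: "(real ^ 'n) set"
  assumes "convex K" and [measurable]: "K \<in> sets borel"
  shows borel_steiner: "steiner i K \<in> sets borel" (is ?borel)
    and emeasure_steiner: "emeasure lborel (steiner i K) = emeasure lborel K" (is ?eq)
proof -
  have iff: "x \<in> steiner i K \<longleftrightarrow> ennreal (2 * \<bar>x $ i\<bar>) < (\<integral>\<^sup>+s. indicator K (coord_upd i x s) \<partial>lborel)" for x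
  proof -
    have [measurable]: "{s. coord_upd i x s \<in> K} \<in> sets borel" by measurable
    have "convex {s. coord_upd i x s \<in> K}"
    proof (rule convexI)
      fix s t u v :: real assume "s \<in> {s. coord_upd i x s \<in> K}" "t \<in> {s. coord_upd i x s \<in> K}" "0 \<le> u" "0 \<le> v" "u + v = 1"
      then show "u *\<^sub>R s + v *\<^sub>R t \<in> {s. coord_upd i x s \<in> K}"
        using convexD[OF \<open>convex K\<close>, of "coord_upd i x s" "coord_upd i x t" u v]
          coord_upd_combination[of i u x v x s t] scaleR_left_distrib[of u v x]
        by simp
    qed
    then have "x \<in> steiner i K \<longleftrightarrow> ennreal (2 * \<bar>x $ i\<bar>) < emeasure lborel {s. coord_upd i x s \<in> K}"
      using less_emeasure_interval_iff[of "{s. coord_upd i x s \<in> K}" "2 * \<bar>x $ i\<bar>"]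
      by (simp add: steiner_def)
    also have "emeasure lborel {s. coord_upd i x s \<in> K} = (\<integral>\<^sup>+s. indicator {s. coord_upd i x s \<in> K} s \<partial>lborel)"
      by simp
    finally show ?thesis by (simp add: indicator_def)
  qed
  have "steiner i K = {x. ennreal (2 * \<bar>x \<bullet> axis i 1\<bar>) < (\<integral>\<^sup>+s. indicator K (coord_upd i x s) \<partial>lborel)}"
    using iff by (auto simp: inner_axis)
  also have "\<dots> \<in> sets borel" by measurable
  finally show borel: ?borel .
  note [measurable] = borel
  have sec: "(\<integral>\<^sup>+s. indicator (steiner i K) (vec_lambda (y(i := s))) \<partial>lborel)
      = (\<integral>\<^sup>+s. (indicator K (vec_lambda (y(i := s))) :: ennreal) \<partial>lborel)" for y
  proof -
    let ?e = "\<integral>\<^sup>+s. indicator K (vec_lambda (y(i := s))) \<partial>lborel"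
    have "(\<integral>\<^sup>+s. indicator (steiner i K) (vec_lambda (y(i := s))) \<partial>lborel)
        = (\<integral>\<^sup>+s. indicator {s::real. ennreal (2 * \<bar>s\<bar>) < ?e} s \<partial>lborel)"
      by (intro nn_integral_cong) (simp add: indicator_def iff coord_upd_vec_lambda)
    also have "\<dots> = emeasure lborel {s::real. ennreal (2 * \<bar>s\<bar>) < ?e}"
      by (rule nn_integral_indicator) measurable
    finally show ?thesis by (simp add: emeasure_symmetric_interval_of_length)
  qed
  have "emeasure lborel (steiner i K) = (\<integral>\<^sup>+x. indicator (steiner i K) x \<partial>lborel)" by simp
  also have "\<dots> = (\<integral>\<^sup>+x. indicator K x \<partial>lborel)"
    by (subst (1 2) nn_integral_vec_coord_inside[of _ i]) (auto simp: sec)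
  finally show ?eq by simp
qed

section \<open>Symmetries and polar of the symmetrised set\<close>

lemma closed_polar: "closed (polar (K :: 'a::real_inner set))"
proof -
  have "polar K = (\<Inter>y\<in>K. {x. x \<bullet> y \<le> 1})" by (auto simp: polar_def)
  then show ?thesis by (auto intro!: closed_INT closed_Collect_le continuous_intros)
qed

lemma convex_steiner:
  fixes K :: "(real ^ 'n) set"
  assumes "convex K"
  shows "convex (steiner i K)"
proof (rule convexI)
  fix x y :: "real ^ 'n" and u v :: real
  assume xy: "x \<in> steiner i K" "y \<in> steiner i K" and uv: "0 \<le> u" "0 \<le> v" "u + v = 1"
  from xy obtain s s' t t' where st: "coord_upd i x s \<in> K" "coord_upd i x s' \<in> K" "2 * \<bar>x $ i\<bar> < s - s'"
      "coord_upd i y t \<in> K" "coord_upd i y t' \<in> K" "2 * \<bar>y $ i\<bar> < t - t'"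
    by (auto simp: steiner_def)
  have "coord_upd i (u *\<^sub>R x + v *\<^sub>R y) (u * s + v * t) \<in> K"
    "coord_upd i (u *\<^sub>R x + v *\<^sub>R y) (u * s' + v * t') \<in> K"
    unfolding coord_upd_combination using st uv by (auto intro: convexD[OF assms])
  moreover have "2 * \<bar>(u *\<^sub>R x + v *\<^sub>R y) $ i\<bar> < (u * s + v * t) - (u * s' + v * t')"
  proof -
    have "2 * \<bar>(u *\<^sub>R x + v *\<^sub>R y) $ i\<bar> \<le> u * (2 * \<bar>x $ i\<bar>) + v * (2 * \<bar>y $ i\<bar>)"
      using uv abs_triangle_ineq[of "u * x $ i" "v * y $ i"] by (simp add: abs_mult)
    also have "\<dots> < u * (s - s') + v * (t - t')"
      using convex_bound_lt[of "2 * \<bar>x $ i\<bar> - (s - s')" 0 "2 * \<bar>y $ i\<bar> - (t - t')" u v] st uv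
      by (simp add: algebra_simps)
    finally show ?thesis by (simp add: algebra_simps)
  qed
  ultimately show "u *\<^sub>R x + v *\<^sub>R y \<in> steiner i K" by (auto simp: steiner_def)
qed

lemma uminus_steiner:
  assumes "\<And>x. x \<in> K \<Longrightarrow> - x \<in> K" and "x \<in> steiner i K"
  shows "- x \<in> steiner i K"
proof -
  obtain s s' where "coord_upd i x s \<in> K" "coord_upd i x s' \<in> K" "2 * \<bar>x $ i\<bar> < s - s'"
    using assms(2) by (auto simp: steiner_def)
  then have "coord_upd i (- x) (- s') \<in> K \<and> coord_upd i (- x) (- s) \<in> K \<and> 2 * \<bar>(- x) $ i\<bar> < (- s') - (- s)"
    using assms(1) by (simp add: coord_upd_uminus)
  then show ?thesis unfolding steiner_def by blast
qed

lemma reflect_steiner_same: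
  "x \<in> steiner i K \<Longrightarrow> coord_upd i x (- x $ i) \<in> steiner i K"
  by (simp add: steiner_def)

lemma reflect_steiner_other:
  assumes "\<And>x. x \<in> K \<Longrightarrow> coord_upd j x (- x $ j) \<in> K" and "i \<noteq> j" and "x \<in> steiner i K"
  shows "coord_upd j x (- x $ j) \<in> steiner i K"
proof -
  obtain s s' where s: "coord_upd i x s \<in> K" "coord_upd i x s' \<in> K" "2 * \<bar>x $ i\<bar> < s - s'"
    using assms(3) by (auto simp: steiner_def)
  have "coord_upd i (coord_upd j x (- x $ j)) t \<in> K" if "coord_upd i x t \<in> K" for t
    using assms(1)[OF that] \<open>i \<noteq> j\<close> by (simp add: coord_upd_commute)
  with s \<open>i \<noteq> j\<close> show ?thesis unfolding steiner_def by auto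
qed

text \<open>By symmetry of \<open>K\<close>, the section of \<open>polar K\<close> at height \<open>-t\<close> is the reflection of the section at height
  \<open>t\<close>. So \<open>x\<close> at height \<open>t\<close> may be paired with \<open>-y\<close> at height \<open>-t\<close>: averaging the inequality for \<open>x\<close> at
  a point \<open>(w, s)\<close> of \<open>K\<close> with the one for \<open>-y\<close> at \<open>(w, s')\<close> leaves the height
  \<open>(s - s') / 2\<close>, and interchanging \<open>s\<close> and \<open>s'\<close> its negative. A point of the symmetrised set above \<open>w\<close>
  lies between two such heights.\<close>

lemma polar_steiner_half_difference:
  assumes sym: "\<And>x. x \<in> K \<Longrightarrow> - x \<in> K"
    and x: "coord_upd i x t \<in> polar K" and y: "coord_upd i y t \<in> polar K"
    and z: "\<And>j. j \<noteq> i \<Longrightarrow> z $ j = (x $ j - y $ j) / 2"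
  shows "coord_upd i z t \<in> polar (steiner i K)"
  unfolding polar_def
proof (intro CollectI ballI)
  fix w assume "w \<in> steiner i K"
  then obtain s s' where s: "coord_upd i w s \<in> K" "coord_upd i w s' \<in> K" "2 * \<bar>w $ i\<bar> < s - s'"
    by (auto simp: steiner_def)
  let ?P = "\<lambda>x. \<Sum>j\<in>UNIV - {i}. x $ j * w $ j"
  have xle: "?P x + t * r \<le> 1" if "coord_upd i w r \<in> K" for r
    using x that by (auto simp: polar_def inner_coord_upd dest!: bspec)
  have yle: "- ?P y - t * r \<le> 1" if "coord_upd i w r \<in> K" for r
  proof -
    have "coord_upd i y t \<bullet> (- coord_upd i w r) \<le> 1"
      using y sym[OF that] by (auto simp: polar_def)
    then show ?thesis by (simp add: inner_coord_upd)
  qed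
  have Pz: "?P z = (?P x - ?P y) / 2"
    by (simp add: z sum_subtractf[symmetric] sum_divide_distrib left_diff_distrib)
  have "\<bar>t\<bar> * (2 * \<bar>w $ i\<bar>) \<le> \<bar>t\<bar> * (s - s')"
    using s(3) by (intro mult_left_mono) auto
  then have "2 * (t * w $ i) \<le> \<bar>t * (s - s')\<bar>"
    using s(3) abs_ge_self[of "t * w $ i"] by (simp add: abs_mult)
  moreover have "\<bar>t * (s - s')\<bar> \<le> 2 - 2 * ?P z"
  proof -
    have "\<bar>d\<bar> \<le> 2 - 2 * p" if "a + b \<le> 1" "a + b' \<le> 1" "- c - b \<le> 1" "- c - b' \<le> 1"
      "p = (a - c) / 2" "d = b - b'" for a b b' c d p :: real
      using that by (simp add: abs_le_iff)
    from this[OF xle[OF s(1)] xle[OF s(2)] yle[OF s(1)] yle[OF s(2)] Pz right_diff_distrib]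
    show ?thesis .
  qed
  ultimately have "?P z + t * w $ i \<le> 1" by linarith
  then show "coord_upd i z t \<bullet> w \<le> 1"
    using inner_coord_upd[of i z t w "w $ i"] by (simp add: coord_upd_self)
qed

lemma ennreal_le_if_mult_self_le:
  fixes a b :: ennreal
  assumes "a * a \<le> b\<^sup>2"
  shows "a \<le> b"
proof (rule ccontr)
  assume "\<not> a \<le> b"
  then have "b < a" by simp
  then obtain y where y: "b = ennreal y" "0 \<le> y" by (cases b) auto
  show False
  proof (cases "a = \<infinity>")
    case True
    then show False using assms y by (simp add: ennreal_power top_unique)
  next
    case False
    then obtain x where x: "a = ennreal x" "0 \<le> x" by (cases a) auto
    have "y < x" using \<open>b < a\<close> x y by (simp add: ennreal_less_iff)
    then have "y\<^sup>2 < x\<^sup>2" using y by (intro power_strict_mono) auto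
    then show False using assms x y by (simp add: ennreal_power power2_eq_square flip: ennreal_mult)
  qed
qed

text \<open>At every height the section of the polar of the symmetrised set contains all half differences of points of
  the section of \<open>polar K\<close>. The Prekopa-Leindler inequality for half differences, applied with
  \<open>f = g\<close>, shows that its measure is at least as large.\<close>

lemma emeasure_polar_le_polar_steiner:
  fixes K :: "(real ^ 'n) set"
  assumes sym: "\<And>x. x \<in> K \<Longrightarrow> - x \<in> K"
  shows "emeasure lborel (polar K) \<le> emeasure lborel (polar (steiner i K))"
proof -
  let ?M = "Pi\<^sub>M (UNIV - {i}) (\<lambda>_. lborel :: real measure)"
  have [measurable]: "polar L \<in> sets borel" for L :: "(real ^ 'n) set"
    by (rule borel_closed[OF closed_polar])
  define P where "P L s = (\<integral>\<^sup>+y. indicator (polar L) (vec_lambda (y(i := s))) \<partial>?M)" for L :: "(real ^ 'n) set" and s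
  have "P K s * P K s \<le> (P (steiner i K) s)\<^sup>2" for s
    unfolding P_def
  proof (rule Prekopa_Leindler_tensorise[OF Prekopa_Leindler_relation_half_difference])
    fix x y z :: "'n \<Rightarrow> real" assume z: "\<forall>j\<in>UNIV - {i}. z j = (x j - y j) / 2"
    have "vec_lambda (z(i := s)) \<in> polar (steiner i K)"
      if "vec_lambda (x(i := s)) \<in> polar K" "vec_lambda (y(i := s)) \<in> polar K"
      using polar_steiner_half_difference[OF sym, of i "vec_lambda x" s "vec_lambda y" "vec_lambda z"] that z
      by (simp add: coord_upd_vec_lambda)
    then show "indicator (polar K) (vec_lambda (x(i := s))) * indicator (polar K) (vec_lambda (y(i := s)))
        \<le> (indicator (polar (steiner i K)) (vec_lambda (z(i := s))) :: ennreal)\<^sup>2"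
      by (auto simp: indicator_def)
  qed (simp, (rule measurable_vec_lambda_coord, rule borel_measurable_indicator,
      simp add: borel_closed closed_polar)+)
  then have P_le: "P K s \<le> P (steiner i K) s" for s by (rule ennreal_le_if_mult_self_le)
  have "emeasure lborel (polar L) = (\<integral>\<^sup>+s. P L s \<partial>lborel)" for L :: "(real ^ 'n) set"
    using nn_integral_vec_coord_outside[of "indicator (polar L)" i] by (simp add: P_def)
  then show ?thesis by (simp add: nn_integral_mono P_le)
qed

section \<open>The Blaschke-Santalo inequality\<close>

text \<open>Symmetrise along the coordinates one after the other; a reflection symmetry in an earlier coordinate
  survives the later symmetrisations.\<close>

lemma exists_unconditional_symmetrisation:
  fixes K :: "(real ^ 'n) set"
  assumes "convex K" "K \<in> sets borel" "\<And>x. x \<in> K \<Longrightarrow> - x \<in> K"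
  shows "\<exists>L :: (real ^ 'n) set. (\<forall>i. \<forall>x\<in>L. coord_upd i x (- x $ i) \<in> L) \<and> L \<in> sets borel
    \<and> emeasure lborel L = emeasure lborel K \<and> emeasure lborel (polar K) \<le> emeasure lborel (polar L)"
proof -
  have "\<exists>L :: (real ^ 'n) set. (\<forall>i\<in>S. \<forall>x\<in>L. coord_upd i x (- x $ i) \<in> L) \<and> convex L \<and> (\<forall>x\<in>L. - x \<in> L) \<and> L \<in> sets borel
    \<and> emeasure lborel L = emeasure lborel K \<and> emeasure lborel (polar K) \<le> emeasure lborel (polar L)"
    if "finite S" for S :: "'n set"
    using that
  proof induction
    case empty
    show ?case by (rule exI[of _ K]) (simp add: assms)
  next
    case (insert i S)
    from insert.IH obtain L :: "(real ^ 'n) set" where L: "\<forall>i\<in>S. \<forall>x\<in>L. coord_upd i x (- x $ i) \<in> L" "convex L" "\<forall>x\<in>L. - x \<in> L"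
        "L \<in> sets borel" "emeasure lborel L = emeasure lborel K"
        "emeasure lborel (polar K) \<le> emeasure lborel (polar L)"
      by blast
    show ?case
    proof (intro exI[of _ "steiner i L"] conjI ballI)
      fix j x assume "j \<in> insert i S" and x: "x \<in> steiner i L"
      then consider "j = i" | "j \<in> S" "j \<noteq> i" by blast
      then show "coord_upd j x (- x $ j) \<in> steiner i L"
      proof cases
        case 2
        then show ?thesis using L(1) x by (intro reflect_steiner_other) auto
      qed (use reflect_steiner_same[OF x] in simp)
    next
      show "emeasure lborel (polar K) \<le> emeasure lborel (polar (steiner i L))"
        using L(3) by (intro order_trans[OF L(6) emeasure_polar_le_polar_steiner]) blast
    next
      show "convex (steiner i L)" by (rule convex_steiner[OF L(2)])
      show "- x \<in> steiner i L" if "x \<in> steiner i L" for x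
        using L(3) that by (intro uminus_steiner) auto
      show "steiner i L \<in> sets borel" by (rule borel_steiner[OF L(2,4)])
      show "emeasure lborel (steiner i L) = emeasure lborel K"
        using emeasure_steiner[OF L(2,4)] L(5) by simp
    qed
  qed
  from this[of UNIV] show ?thesis by auto
qed

lemma unconditional_flip_set:
  fixes L :: "(real ^ 'n) set"
  assumes "\<And>i x. x \<in> L \<Longrightarrow> coord_upd i x (- x $ i) \<in> L" and "x \<in> L" and "finite T"
  shows "(\<chi> j. if j \<in> T then - x $ j else x $ j) \<in> L"
  using assms(3)
proof induction
  case empty
  then show ?case using assms(2) by simp
next
  case (insert i T)
  have "coord_upd i (\<chi> j. if j \<in> T then - x $ j else x $ j) (- x $ i) = (\<chi> j. if j \<in> insert i T then - x $ j else x $ j)"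
    by (simp add: vec_eq_iff)
  then show ?case using assms(1)[OF insert.IH, of i] insert.hyps by simp
qed

text \<open>Reflecting \<open>x\<close> in the coordinates where \<open>x i * y i < 0\<close> stays inside \<open>L\<close> and turns the inner
  product with \<open>y\<close> into \<open>(\<Sum>i. \<bar>x i * y i\<bar>)\<close>.\<close>

lemma Blaschke_Santalo_unconditional:
  fixes L :: "(real ^ 'n) set"
  assumes flip: "\<And>i x. x \<in> L \<Longrightarrow> coord_upd i x (- x $ i) \<in> L" and L[measurable]: "L \<in> sets borel"
  shows "emeasure lborel L * emeasure lborel (polar L) \<le> (emeasure lborel (cball 0 1 :: (real ^ 'n) set))\<^sup>2"
proof -
  have [measurable]: "polar L \<in> sets borel"
    by (rule borel_closed[OF closed_polar])
  have emeasure_eq: "emeasure lborel A = (\<integral>\<^sup>+y. indicator A (vec_lambda y) \<partial>Pi\<^sub>M UNIV (\<lambda>_. lborel))"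
    if "A \<in> sets borel" for A :: "(real ^ 'n) set"
    using nn_integral_vec[of "indicator A"] that by simp
  have "(\<integral>\<^sup>+x. indicator L (vec_lambda x) \<partial>Pi\<^sub>M UNIV (\<lambda>_. lborel))
      * (\<integral>\<^sup>+x. indicator (polar L) (vec_lambda x) \<partial>Pi\<^sub>M UNIV (\<lambda>_. lborel))
      \<le> (\<integral>\<^sup>+x. indicator (cball 0 1 :: (real ^ 'n) set) (vec_lambda x) \<partial>Pi\<^sub>M UNIV (\<lambda>_. lborel))\<^sup>2"
  proof (rule Prekopa_Leindler_tensorise[OF Prekopa_Leindler_relation_geometric_mean])
    fix x y z :: "'n \<Rightarrow> real" assume z: "\<forall>i\<in>UNIV. (z i)\<^sup>2 = \<bar>x i * y i\<bar>"
    have "vec_lambda z \<in> (cball 0 1 :: (real ^ 'n) set)" if x: "vec_lambda x \<in> L" and y: "vec_lambda y \<in> polar L"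
    proof -
      let ?x = "(\<chi> j. if j \<in> {j. x j * y j < 0} then - vec_lambda x $ j else vec_lambda x $ j) :: real ^ 'n"
      have "?x \<in> L" using flip x by (rule unconditional_flip_set) auto
      with y have "vec_lambda y \<bullet> ?x \<le> 1" by (simp add: polar_def)
      also have "vec_lambda y \<bullet> ?x = (\<Sum>i\<in>UNIV. \<bar>x i * y i\<bar>)"
        unfolding inner_vec_def by (intro sum.cong) (auto simp: abs_if mult.commute)
      also have "\<dots> = vec_lambda z \<bullet> (vec_lambda z :: real ^ 'n)"
        using z by (simp add: inner_vec_def power2_eq_square)
      finally show ?thesis by (simp add: norm_eq_sqrt_inner)
    qed
    then show "indicator L (vec_lambda x) * indicator (polar L) (vec_lambda y)
        \<le> (indicator (cball 0 1 :: (real ^ 'n) set) (vec_lambda z) :: ennreal)\<^sup>2"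
      by (auto simp: indicator_def)
  qed (simp, (rule measurable_compose[OF measurable_vec_lambda], rule borel_measurable_indicator,
      simp add: borel_closed closed_polar L)+)
  then show ?thesis by (simp add: emeasure_eq)
qed

text \<open>If one of the factors is infinite, the inequality says that the other one vanishes, because
  \<open>\<infinity> * 0 = 0\<close> for extended nonnegative reals.\<close>

theorem Blaschke_Santalo:
  fixes K :: "(real ^ 'n) set"
  assumes "convex K" "K \<in> sets borel" "\<And>x. x \<in> K \<Longrightarrow> - x \<in> K"
  shows "emeasure lborel K * emeasure lborel (polar K) \<le> (emeasure lborel (cball 0 1 :: (real ^ 'n) set))\<^sup>2"
proof -
  obtain L :: "(real ^ 'n) set" where L: "\<And>i x. x \<in> L \<Longrightarrow> coord_upd i x (- x $ i) \<in> L" "L \<in> sets borel"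
    "emeasure lborel L = emeasure lborel K" "emeasure lborel (polar K) \<le> emeasure lborel (polar L)"
    using exists_unconditional_symmetrisation[OF assms] by blast
  have "emeasure lborel K * emeasure lborel (polar K) \<le> emeasure lborel L * emeasure lborel (polar L)"
    unfolding L(3) by (intro mult_left_mono L(4)) simp
  also have "\<dots> \<le> (emeasure lborel (cball 0 1 :: (real ^ 'n) set))\<^sup>2"
    by (rule Blaschke_Santalo_unconditional) (fact L)+
  finally show ?thesis .
qed

section \<open>Level sets and the Legendre transform\<close>

text \<open>Closedness supplies the measurability of the larger set in the final comparison of volumes.\<close>

lemma closed_legendre_sublevel: "closed {x. legendre g x \<le> ereal lam}"
proof -
  have "{x. legendre g x \<le> ereal lam} = (\<Inter>y. {x. ereal (x \<bullet> y) - g y \<le> ereal lam})"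
    by (auto simp: legendre_def SUP_le_iff)
  moreover have "closed {x. ereal (x \<bullet> y) - g y \<le> ereal lam}" for y
  proof (cases "g y")
    case (real r)
    then have "{x. ereal (x \<bullet> y) - g y \<le> ereal lam} = {x. x \<bullet> y \<le> lam + r}" by auto
    then show ?thesis by (auto intro!: closed_Collect_le continuous_intros)
  qed auto
  ultimately show ?thesis by auto
qed

text \<open>The hypothesis says that \<open>y\<close> avoids the rearranged level sets \<open>{f < t}\<close> for all \<open>t\<close> below
  \<open>c = x \<bullet> y - lam\<close>. With \<open>t = - ln s\<close>, the integrand defining \<open>symm_decr\<close> then vanishes for
  \<open>s > exp (-c)\<close>, so the rearrangement of \<open>exp (-f)\<close> is at most \<open>exp (-c)\<close> at \<open>y\<close>.\<close>

lemma legendre_le_symm_incr: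
  assumes "\<And>t y. y \<in> symm_set {z. f z < t} \<Longrightarrow> x \<bullet> y - lam \<le> t"
  shows "legendre (symm_incr f) x \<le> ereal lam"
  unfolding legendre_def
proof (rule SUP_least)
  fix y
  let ?c = "x \<bullet> y - lam"
  have "symm_decr (\<lambda>z. exp (- f z)) y \<le> (\<integral>\<^sup>+s. indicator {0..exp (- ?c)} s \<partial>lborel)"
    unfolding symm_decr_def
  proof (rule nn_integral_mono)
    fix s :: real
    have "s \<le> exp (- ?c)" if s: "0 \<le> s" and y: "y \<in> symm_set {z. s < exp (- f z)}"
    proof (cases "s = 0")
      case False
      then have *: "s < exp u \<longleftrightarrow> ln s < u" for u
        using s by (metis exp_less_cancel_iff exp_ln less_eq_real_def)
      have "{z. s < exp (- f z)} = {z. f z < - ln s}"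
        by (intro Collect_cong) (unfold *, linarith)
      with y have "?c \<le> - ln s" by (intro assms) simp
      then have "ln s \<le> - ?c" by simp
      then show ?thesis using s False by (metis exp_le_cancel_iff exp_ln less_eq_real_def)
    qed simp
    then show "indicator (symm_set {z. s < exp (- f z)}) y * indicator {0..} s \<le> (indicator {0..exp (- ?c)} s :: ennreal)"
      by (auto simp: indicator_def)
  qed
  also have "\<dots> = ennreal (exp (- ?c))" by simp
  finally have le: "symm_decr (\<lambda>z. exp (- f z)) y \<le> ennreal (exp (- ?c))" .
  have "ereal ?c \<le> symm_incr f y"
  proof (cases "symm_decr (\<lambda>z. exp (- f z)) y = 0")
    case False
    then obtain r where r: "symm_decr (\<lambda>z. exp (- f z)) y = ennreal r" "r > 0"
      using le by (cases "symm_decr (\<lambda>z. exp (- f z)) y") (auto simp: top_unique)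
    then have "ln r \<le> - ?c" using le by (metis ennreal_le_iff exp_ge_zero exp_gt_zero ln_exp ln_le_cancel_iff)
    then show ?thesis using r by (simp add: symm_incr_def ext_ln_def)
  qed (simp add: symm_incr_def ext_ln_def)
  then show "ereal (x \<bullet> y) - symm_incr f y \<le> ereal lam"
    by (cases "symm_incr f y") auto
qed

lemma exists_unique_ball_of_volume:
  assumes "v \<noteq> \<infinity>"
  shows "\<exists>!r. 0 \<le> r \<and> emeasure lborel (ball (0 :: 'a::euclidean_space) r) = v"
proof -
  define B where "B = unit_ball_vol (DIM('a))"
  obtain w where w: "v = ennreal w" "0 \<le> w" using assms by (cases v) auto
  have B: "B > 0" by (simp add: B_def)
  have iff: "0 \<le> r \<and> emeasure lborel (ball (0 :: 'a) r) = v \<longleftrightarrow> 0 \<le> r \<and> r ^ DIM('a) = w / B" for r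
    using w B by (auto simp: emeasure_ball field_simps simp flip: B_def)
  show ?thesis unfolding iff
  proof (rule ex1I[of _ "root DIM('a) (w / B)"])
    show "0 \<le> root DIM('a) (w / B) \<and> root DIM('a) (w / B) ^ DIM('a) = w / B"
      using w B by (auto simp: real_root_pow_pos2)
    show "r = root DIM('a) (w / B)" if "0 \<le> r \<and> r ^ DIM('a) = w / B" for r
      using that by (metis DIM_positive real_root_power_cancel)
  qed
qed

lemma symm_set_eq_ball:
  fixes A :: "'a::euclidean_space set"
  assumes "emeasure lebesgue A \<noteq> \<infinity>"
  obtains r where "0 \<le> r" "symm_set A = ball 0 r" "emeasure lborel (ball (0::'a) r) = emeasure lebesgue A"
proof -
  let ?r = "THE r. 0 \<le> r \<and> emeasure lebesgue (ball (0::'a) r) = emeasure lebesgue A"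
  have "0 \<le> ?r \<and> emeasure lebesgue (ball (0::'a) ?r) = emeasure lebesgue A"
    by (rule theI') (use exists_unique_ball_of_volume[OF assms, where 'a = 'a] in simp)
  then show ?thesis using assms by (intro that[of ?r]) (auto simp: symm_set_def)
qed

lemma symm_set_empty: "symm_set ({} :: 'a::euclidean_space set) = {}"
proof -
  obtain r where r: "0 \<le> r" "symm_set ({} :: 'a set) = ball 0 r"
      "emeasure lborel (ball (0 :: 'a) r) = emeasure lebesgue ({} :: 'a set)"
    by (rule symm_set_eq_ball[of "{} :: 'a set"]) auto
  then have "\<not> 0 < r"
    using open_not_negligible[of "ball (0 :: 'a) r"] by (auto simp: negligible_iff_emeasure0)
  with r(1,2) show ?thesis by simp
qed

lemma emeasure_scaled_set:
  fixes A :: "'a::euclidean_space set"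
  assumes "0 \<le> c"
  shows "emeasure lebesgue ((\<lambda>x. c *\<^sub>R x) ` A) = ennreal (c ^ DIM('a)) * emeasure lebesgue A"
  using emeasure_lebesgue_affine[of c 0 A] assms by simp

lemma legendre_sublevel_subset_scaled_polar:
  fixes f :: "'a::euclidean_space \<Rightarrow> real"
  assumes "0 < lam + t"
  shows "{x. legendre (\<lambda>y. ereal (f y)) x \<le> ereal lam} \<subseteq> (\<lambda>x. (lam + t) *\<^sub>R x) ` polar {y. f y < t}"
proof
  fix x assume "x \<in> {x. legendre (\<lambda>y. ereal (f y)) x \<le> ereal lam}"
  then have le: "x \<bullet> y - f y \<le> lam" for y
    by (auto simp: legendre_def SUP_le_iff)
  have "(1 / (lam + t)) *\<^sub>R x \<in> polar {y. f y < t}"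
    unfolding polar_def
  proof (intro CollectI ballI)
    fix y assume "y \<in> {y. f y < t}"
    then show "((1 / (lam + t)) *\<^sub>R x) \<bullet> y \<le> 1" using le[of y] assms by simp
  qed
  then show "x \<in> (\<lambda>x. (lam + t) *\<^sub>R x) ` polar {y. f y < t}"
    using assms by (intro image_eqI[of _ _ "(1 / (lam + t)) *\<^sub>R x"]) auto
qed

theorem theorem4p3:
  fixes f :: "real ^ 'n \<Rightarrow> real" and lam :: real
  assumes "\<And>x. 0 \<le> f x"
    and "convex_on UNIV f"
    and "\<And>x. f (- x) = f x"
    and "f 0 = 0"
  shows "emeasure lebesgue {x. legendre (\<lambda>y. ereal (f y)) x \<le> ereal lam}
       \<le> emeasure lebesgue {x. legendre (symm_incr f) x \<le> ereal lam}"
proof -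
  let ?n = "DIM(real ^ 'n)"
  let ?L = "{x. legendre (\<lambda>y. ereal (f y)) x \<le> ereal lam}"
  let ?A = "\<lambda>t. {y. f y < t}"
  let ?\<omega> = "emeasure lborel (cball 0 1 :: (real ^ 'n) set)"
  define V where "V = emeasure lebesgue ?L"
  consider "V = 0" | "lam < 0" | "0 \<le> lam" "V \<noteq> 0" by linarith
  then show ?thesis
  proof cases
    case 2
    have "x \<notin> ?L" for x
    proof
      assume "x \<in> ?L"
      then have "ereal (x \<bullet> 0) - ereal (f 0) \<le> ereal lam"
        unfolding legendre_def mem_Collect_eq by (rule order_trans[OF SUP_upper[OF UNIV_I]])
      then show False using assms(4) 2 by simp
    qed
    then have "?L = {}" by blast
    then show ?thesis by simp
  next
    case 3
    have cont: "continuous_on UNIV f"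
      using assms(2) by (intro convex_on_continuous) auto
    have open_A: "open (?A t)" for t
      using cont by (intro open_Collect_less continuous_intros)
    have convex_A: "convex (?A t)" for t
    proof (rule convexI)
      fix x y :: "real ^ 'n" and u v :: real
      assume xy: "x \<in> ?A t" "y \<in> ?A t" and uv: "0 \<le> u" "0 \<le> v" "u + v = 1"
      have "f (u *\<^sub>R x + v *\<^sub>R y) \<le> u * f x + v * f y"
        using assms(2) uv by (simp add: convex_on_def)
      also have "\<dots> < t" using xy uv by (intro convex_bound_lt) auto
      finally show "u *\<^sub>R x + v *\<^sub>R y \<in> ?A t" by simp
    qed
    \<comment> \<open>The polar bound on one level set, combined with Blaschke-Santalo for that level set.\<close>
    have BS: "emeasure lebesgue (?A t) * V \<le> ennreal ((lam + t) ^ ?n) * ?\<omega>\<^sup>2" if "0 < t" for t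
    proof -
      have lamt: "0 < lam + t" using that 3 by simp
      have "V \<le> emeasure lebesgue ((\<lambda>x. (lam + t) *\<^sub>R x) ` polar (?A t))"
        unfolding V_def
        by (intro emeasure_mono legendre_sublevel_subset_scaled_polar lamt sets_completionI_sets)
          (simp add: borel_closed closed_scaling closed_polar)
      also have "\<dots> = ennreal ((lam + t) ^ ?n) * emeasure lborel (polar (?A t))"
        using lamt by (subst emeasure_scaled_set) (auto simp: closed_polar borel_closed)
      finally have "emeasure lebesgue (?A t) * V
          \<le> emeasure lebesgue (?A t) * (ennreal ((lam + t) ^ ?n) * emeasure lborel (polar (?A t)))"
        by (rule mult_left_mono) simp
      also have "\<dots> = ennreal ((lam + t) ^ ?n) * (emeasure lborel (?A t) * emeasure lborel (polar (?A t)))"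
        using open_A by (simp add: mult_ac)
      also have "\<dots> \<le> ennreal ((lam + t) ^ ?n) * ?\<omega>\<^sup>2"
        using open_A convex_A assms(3) by (intro mult_left_mono Blaschke_Santalo) auto
      finally show ?thesis .
    qed
    have \<omega>: "?\<omega> = ennreal (unit_ball_vol ?n)" by (simp add: emeasure_cball)
    have finite_bound: "ennreal ((lam + t) ^ ?n) * ?\<omega>\<^sup>2 < \<infinity>" for t
      unfolding \<omega> by (simp add: ennreal_power ennreal_mult_less_top)
    \<comment> \<open>Since \<open>V > 0\<close>, the finite bound prevents level sets of infinite volume.\<close>
    have A_fin: "emeasure lebesgue (?A t) \<noteq> \<infinity>" if "0 < t" for t
      using BS[OF that] finite_bound[of t] 3(2) by (auto simp: ennreal_top_mult top_unique)
    \<comment> \<open>One level set of positive volume suffices to bound \<open>V\<close>.\<close>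
    have "V \<noteq> \<infinity>"
    proof
      assume "V = \<infinity>"
      moreover have "emeasure lebesgue (?A 1) \<noteq> 0"
      proof
        assume "emeasure lebesgue (?A 1) = 0"
        then have "negligible (?A 1)"
          using open_A[of 1] by (simp add: negligible_iff_emeasure0)
        then have "?A 1 = {}" using open_A[of 1] open_not_negligible by blast
        moreover have "0 \<in> ?A 1" using assms(4) by simp
        ultimately show False by blast
      qed
      ultimately show False
        using BS[of 1] finite_bound[of 1] by (auto simp: ennreal_mult_top top_unique)
    qed
    from ex1_implies_ex[OF exists_unique_ball_of_volume[OF this, where 'a = "real ^ 'n"]]
    obtain \<rho> where \<rho>: "0 \<le> \<rho>" "emeasure lborel (ball (0 :: real ^ 'n) \<rho>) = V"
      by (elim exE conjE) (rule that)
    have "(ball 0 \<rho> :: (real ^ 'n) set) \<subseteq> {x. legendre (symm_incr f) x \<le> ereal lam}"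
    proof (rule subsetI, rule CollectI, rule legendre_le_symm_incr)
      fix x y :: "real ^ 'n" and t :: real
      assume x: "x \<in> ball 0 \<rho>" and y: "y \<in> symm_set (?A t)"
      have "0 < t"
      proof (rule ccontr)
        assume "\<not> 0 < t"
        then have "?A t = {}" using assms(1) by (auto simp: not_less intro: order_trans)
        then show False using y by (simp add: symm_set_empty)
      qed
      obtain r where r: "0 \<le> r" "symm_set (?A t) = ball 0 r"
          "emeasure lborel (ball (0 :: real ^ 'n) r) = emeasure lebesgue (?A t)"
        using A_fin[OF \<open>0 < t\<close>] by (rule symm_set_eq_ball)
      \<comment> \<open>In terms of the radii the bound is \<open>(r \<rho>)^n \<le> (lam + t)^n\<close>, which
        is what Cauchy-Schwarz needs for \<open>x\<close> and \<open>y\<close>.\<close>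
      let ?b = "unit_ball_vol ?n"
      have b: "?b > 0" by simp
      have "ennreal (?b * r ^ ?n) * ennreal (?b * \<rho> ^ ?n) \<le> ennreal ((lam + t) ^ ?n) * (ennreal ?b)\<^sup>2"
        using BS[OF \<open>0 < t\<close>] unfolding r(3)[symmetric] \<rho>(2)[symmetric] \<omega>
        using r(1) \<rho>(1) by (simp add: emeasure_ball)
      then have "(?b * r ^ ?n) * (?b * \<rho> ^ ?n) \<le> (lam + t) ^ ?n * ?b\<^sup>2"
        using r(1) \<rho>(1) b 3 \<open>0 < t\<close> by (simp add: ennreal_power flip: ennreal_mult)
      then have "(r * \<rho>) ^ ?n \<le> (lam + t) ^ ?n"
        using b by (simp add: power2_eq_square power_mult_distrib mult_ac)
      then have "r * \<rho> \<le> lam + t"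
        using r(1) \<rho>(1) 3(1) \<open>0 < t\<close> by (subst (asm) power_mono_iff) auto
      moreover have "x \<bullet> y \<le> \<rho> * r"
        using x y r \<rho> by (intro order_trans[OF norm_cauchy_schwarz] mult_mono) auto
      ultimately show "x \<bullet> y - lam \<le> t" by (simp add: mult.commute)
    qed
    then have "emeasure lebesgue (ball (0 :: real ^ 'n) \<rho>) \<le> emeasure lebesgue {x. legendre (symm_incr f) x \<le> ereal lam}"
      by (intro emeasure_mono sets_completionI_sets) (simp_all add: borel_closed closed_legendre_sublevel)
    then show ?thesis using \<rho> by (simp add: V_def)
  qed (simp add: V_def)
qed

end
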